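(* Let $\mathcal{A} = (A, \vee, \wedge, 0, 1, \widehat{\ })$ be a Boolean algebra and let $x \in A$. The map $\phi : A \times A \to A \times A$ defined by $$\phi(a, b) = \bigl(a \vee (x \wedge b),\ (\widehat{x} \vee (x \wedge a)) \wedge b\bigr)$$ satisfies the Braid Condition $$\phi^{12} \circ \phi^{23} \circ \phi^{12} = \phi^{23} \circ \phi^{12} \circ \phi^{23}$$ as maps $A \times A \times A \to A \times A \times A$.
   Context: In a Boolean algebra $A$, $\widehat{a}$ denotes the complement of $a$. For a map $\phi : A \times A \to A \times A$, $\phi^{12} = \phi \times \mathrm{Id}_A$ and $\phi^{23} = \mathrm{Id}_A \times \phi$ are the maps $A \times A \times A \to A \times A \times A$ applying $\phi$ to the first two, respectively last two, components. *)

theory Defs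
  imports Main
begin

unbundle lattice_syntax

text \<open>Triples are right-nested: the type \<open>'a \<times> 'a \<times> 'a\<close> is \<open>'a \<times> ('a \<times> 'a)\<close>.
  Hence the map acting on the last two components is literally a product map, while the one acting
  on the first two components has to reassociate.\<close>

definition on12 :: "('a \<times> 'a \<Rightarrow> 'a \<times> 'a) \<Rightarrow> 'a \<times> 'a \<times> 'a \<Rightarrow> 'a \<times> 'a \<times> 'a" where
  "on12 \<phi> = (\<lambda>(a, b, c). case \<phi> (a, b) of (a', b') \<Rightarrow> (a', b', c))"

definition on23 :: "('a \<times> 'a \<Rightarrow> 'a \<times> 'a) \<Rightarrow> 'a \<times> 'a \<times> 'a \<Rightarrow> 'a \<times> 'a \<times> 'a" where
  "on23 \<phi> = map_prod id \<phi>"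

definition braid_condition :: "('a \<times> 'a \<Rightarrow> 'a \<times> 'a) \<Rightarrow> bool" where
  "braid_condition \<phi> \<longleftrightarrow> on12 \<phi> \<circ> on23 \<phi> \<circ> on12 \<phi> = on23 \<phi> \<circ> on12 \<phi> \<circ> on23 \<phi>"

definition boolean_braid_map :: "'a::boolean_algebra \<Rightarrow> 'a \<times> 'a \<Rightarrow> 'a \<times> 'a" where
  "boolean_braid_map x = (\<lambda>(a, b). (a \<squnion> (x \<sqinter> b), (- x \<squnion> (x \<sqinter> a)) \<sqinter> b))"

end

theory Submission
  imports Defs
begin

text \<open>An element \<open>u\<close> is determined by \<open>x \<sqinter> u\<close> and \<open>- x \<sqinter> u\<close>. Below \<open>x\<close> the map is
  \<open>(a, b) \<mapsto> (a \<squnion> b, a \<sqinter> b)\<close>, for which both sides of the braid condition sort a triple;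
  below \<open>- x\<close> it is the identity.\<close>

lemma eq_if_inf_eq_inf_compl:
  fixes x u v :: "'a::boolean_algebra"
  assumes "x \<sqinter> u = x \<sqinter> v" "- x \<sqinter> u = - x \<sqinter> v"
  shows "u = v"
proof -
  have "w = (x \<sqinter> w) \<squnion> (- x \<sqinter> w)" for w
    by (simp flip: inf_sup_distrib2)
  with assms show ?thesis by metis
qed

text \<open>Naming the two components keeps iterated applications as nested constants, so that meets
  can be pushed inward without expanding large Boolean terms.\<close>

definition braid_fst :: "'a::boolean_algebra \<Rightarrow> 'a \<Rightarrow> 'a \<Rightarrow> 'a" where
  "braid_fst x a b = a \<squnion> (x \<sqinter> b)"

definition braid_snd :: "'a::boolean_algebra \<Rightarrow> 'a \<Rightarrow> 'a \<Rightarrow> 'a" where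
  "braid_snd x a b = (- x \<squnion> (x \<sqinter> a)) \<sqinter> b"

lemma boolean_braid_map_apply:
  "boolean_braid_map x (a, b) = (braid_fst x a b, braid_snd x a b)"
  by (simp add: boolean_braid_map_def braid_fst_def braid_snd_def)

text \<open>Meeting with \<open>x\<close> cancels the \<open>- x\<close> in
  \<open>braid_snd\<close>. The right-hand sides again contain meets of \<open>x\<close> with the
  arguments, so rewriting descends through nested applications.\<close>

lemma inf_braid:
  "x \<sqinter> braid_fst x a b = (x \<sqinter> a) \<squnion> (x \<sqinter> b)"
  "x \<sqinter> braid_snd x a b = (x \<sqinter> a) \<sqinter> (x \<sqinter> b)"
  by (simp_all add: braid_fst_def braid_snd_def inf_sup_distrib1 inf_sup_distrib2 inf_aci)

text \<open>Meeting with \<open>- x\<close> kills \<open>x \<sqinter> b\<close>, and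
  \<open>- x\<close> lies below the first factor of \<open>braid_snd\<close>.\<close>

lemma inf_compl_braid:
  "- x \<sqinter> braid_fst x a b = - x \<sqinter> a"
  "- x \<sqinter> braid_snd x a b = - x \<sqinter> b"
  by (simp_all add: braid_fst_def braid_snd_def inf_sup_distrib1 inf_sup_distrib2
      flip: inf_assoc)

text \<open>For the map \<open>(a, b) \<mapsto> (a \<squnion> b, a \<sqinter> b)\<close>, these are
  the components of the braid condition: left sides from the order 12, 23, 12, right sides from 23,
  12, 23.\<close>

lemma lattice_sort:
  fixes a b c :: "'a::distrib_lattice"
  shows lattice_sort_fst: "(a \<squnion> b) \<squnion> ((a \<sqinter> b) \<squnion> c) = a \<squnion> (b \<squnion> c)"
    and lattice_sort_snd: "(a \<squnion> b) \<sqinter> ((a \<sqinter> b) \<squnion> c) = (a \<sqinter> (b \<squnion> c)) \<squnion> (b \<sqinter> c)"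
    and lattice_sort_thd: "(a \<sqinter> b) \<sqinter> c = (a \<sqinter> (b \<squnion> c)) \<sqinter> (b \<sqinter> c)"
proof -
  have le: "a \<sqinter> b \<le> a \<squnion> b"
    by (simp add: le_infI1)
  have "(a \<squnion> b) \<squnion> ((a \<sqinter> b) \<squnion> c) = (a \<squnion> b) \<squnion> (a \<sqinter> b) \<squnion> c"
    by (simp only: sup_assoc)
  also have "\<dots> = a \<squnion> (b \<squnion> c)"
    by (subst sup_absorb1[OF le]) (rule sup_assoc)
  finally show "(a \<squnion> b) \<squnion> ((a \<sqinter> b) \<squnion> c) = a \<squnion> (b \<squnion> c)" .
  have "(a \<squnion> b) \<sqinter> ((a \<sqinter> b) \<squnion> c) = (a \<sqinter> b) \<squnion> ((a \<squnion> b) \<sqinter> c)"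
    by (simp only: inf_sup_distrib1[of "a \<squnion> b"] inf_absorb2[OF le])
  \<comment> \<open>Both sides expand to the median, the join of the three pairwise meets.\<close>
  also have "\<dots> = (a \<sqinter> (b \<squnion> c)) \<squnion> (b \<sqinter> c)"
    by (simp only: inf_sup_distrib1 inf_sup_distrib2 sup_assoc)
  finally show "(a \<squnion> b) \<sqinter> ((a \<sqinter> b) \<squnion> c) = (a \<sqinter> (b \<squnion> c)) \<squnion> (b \<sqinter> c)" .
  have "b \<sqinter> c \<le> b \<squnion> c"
    by (simp add: le_infI1)
  then have "(b \<squnion> c) \<sqinter> (b \<sqinter> c) = b \<sqinter> c"
    by (rule inf_absorb2)
  then show "(a \<sqinter> b) \<sqinter> c = (a \<sqinter> (b \<squnion> c)) \<sqinter> (b \<sqinter> c)"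
    by (simp only: inf_assoc)
qed

theorem theorem5p12:
  fixes x :: "'a::boolean_algebra"
  shows "braid_condition (boolean_braid_map x)"
proof -
  have "(on12 (boolean_braid_map x) \<circ> on23 (boolean_braid_map x) \<circ> on12 (boolean_braid_map x)) (a, b, c)
      = (on23 (boolean_braid_map x) \<circ> on12 (boolean_braid_map x) \<circ> on23 (boolean_braid_map x)) (a, b, c)"
    for a b c
    \<comment> \<open>Each component splits into two goals: below \<open>- x\<close> both sides
      collapse to the same meet, and below \<open>x\<close> an instance of
      \<open>lattice_sort\<close> remains.\<close>
    by (simp add: on12_def on23_def boolean_braid_map_apply)
      (intro conjI; rule eq_if_inf_eq_inf_compl[of x];
        simp only: inf_braid inf_compl_braid; rule lattice_sort)
  then show ?thesis
    by (auto simp: braid_condition_def)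
qed

end
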